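(* Let $\ell^{n}=\{M,H\}$ be a Cartan space with $(\alpha,\beta)$-metric, considered on the region $U\subset T^{*}M\setminus\{0\}$, whose invariants are $$\rho_{1}=\frac{\alpha\beta^{2}-2\alpha^{2}\beta}{2(\beta-\alpha)^{2}},\quad \rho=\frac{\beta^{3}}{2\alpha(\beta-\alpha)^{2}},\quad \rho_{0}=\frac{\alpha^{3}}{(\beta-\alpha)^{3}},\quad \rho_{-1}=\frac{\beta^{3}-3\alpha\beta^{2}}{2\alpha(\beta-\alpha)^{3}},\quad \rho_{-2}=\frac{\beta^{3}(3\alpha-\beta)}{2\alpha^{3}(\beta-\alpha)^{3}},$$ $$r_{-1}=\frac{-3\alpha^{3}}{(\beta-\alpha)^{4}},\quad r_{-2}=\frac{3\alpha\beta}{(\beta-\alpha)^{4}},\quad r_{-3}=\frac{4\alpha\beta^{3}-\beta^{4}-9\alpha^{2}\beta^{2}}{2\alpha^{3}(\beta-\alpha)^{4}},\quad r_{-4}=\frac{15\alpha^{2}\beta^{3}+3\beta^{5}-12\alpha\beta^{4}}{2\alpha^{5}(\beta-\alpha)^{4}}.$$ Then $\ell^{n}$ is the Cartan space with fundamental function $H(\alpha,\beta)=\dfrac{\alpha\beta^{2}}{\beta-\alpha}$ on $U$.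
   Context: $M$ is an $n$-dimensional smooth manifold, $(x,y)=(x^i,y_i)$ are the canonical coordinates on $T^{*}M$, and summation over repeated indices is understood. $a^{ij}(x)$ is a (contravariant) Riemannian metric on $M$, $b^{i}(x)$ a vector field on $M$, and $\alpha(x,y)=\sqrt{a^{ij}(x)y_iy_j}$, $\beta(x,y)=b^{i}(x)y_i$. $U$ denotes the region of $T^{*}M\setminus\{0\}$ (zero section removed) where $\beta>0$ and $\alpha<\beta$. A Cartan space $\ell^{n}=\{M,H(x,y)\}$ is given by a fundamental function $H(x,y)$ positively homogeneous of degree $2$ in $y$ whose fundamental tensor $g^{ij}=\frac12\frac{\partial^2 H}{\partial y_i\partial y_j}$ is nondegenerate. It is a Cartan space with $(\alpha,\beta)$-metric if $H(x,y)=H(\alpha(x,y),\beta(x,y))$ is a (smooth) function of $\alpha$ and $\beta$ only; the function $H(\alpha,\beta)$ is then positively homogeneous of degree $2$ in $(\alpha,\beta)$. Subscripts on $H$ denote partial derivatives of $H(\alpha,\beta)$. The invariants of a Cartan space with $(\alpha,\beta)$-metric are $$\rho_{1}=\tfrac12H_{\beta},\quad \rho=\tfrac{1}{2\alpha}H_{\alpha},\quad \rho_{0}=\tfrac12H_{\beta\beta},\quad \rho_{-1}=\tfrac{1}{2\alpha}H_{\alpha\beta},\quad \rho_{-2}=\tfrac{1}{2\alpha^{2}}\left(H_{\alpha\alpha}-\alpha^{-1}H_{\alpha}\right),$$ $$r_{-1}=\tfrac12H_{\beta\beta\beta},\quad r_{-2}=\tfrac{1}{2\alpha}H_{\alpha\beta\beta},\quad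 r_{-3}=\tfrac{1}{2\alpha^{2}}\left(H_{\alpha\alpha\beta}-\alpha^{-1}H_{\alpha\beta}\right),\quad r_{-4}=\tfrac{1}{2\alpha^{3}}\left(H_{\alpha\alpha\alpha}-3\alpha^{-1}H_{\alpha\alpha}+3\alpha^{-2}H_{\alpha}\right).$$ *)

theory Defs
  imports "HOL-Analysis.Analysis"
begin

section \<open>Smooth maps between Euclidean spaces\<close>

text \<open>Both notions are meant for open \<open>S\<close>.\<close>

primrec Ck_on ::
  "nat \<Rightarrow> 'a::euclidean_space set \<Rightarrow> ('a \<Rightarrow> 'b::real_normed_vector) \<Rightarrow> bool" where
  "Ck_on 0 S f \<longleftrightarrow> continuous_on S f"
| "Ck_on (Suc k) S f \<longleftrightarrow>
     (\<forall>x\<in>S. f differentiable (at x)) \<and>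
     (\<forall>v. Ck_on k S (\<lambda>x. frechet_derivative f (at x) v))"

definition smooth_on ::
  "'a::euclidean_space set \<Rightarrow> ('a \<Rightarrow> 'b::real_normed_vector) \<Rightarrow> bool" where
  "smooth_on S f \<longleftrightarrow> (\<forall>k. Ck_on k S f)"


section \<open>Manifolds and their cotangent bundle\<close>

text \<open>
  A chart is a pair of its domain and its coordinate map; the values of the coordinate map outside
  of the domain are irrelevant. The dimension \<open>n\<close> of the manifold is the cardinality of the index
  type \<open>'n\<close>.
\<close>

type_synonym ('m, 'n) chart = "'m set \<times> ('m \<Rightarrow> real^'n)"

definition chart_inv :: "('m, 'n::finite) chart \<Rightarrow> real^'n \<Rightarrow> 'm" where
  "chart_inv c = the_inv_into (fst c) (snd c)"

definition charts_at :: "('m, 'n::finite) chart set \<Rightarrow> 'm \<Rightarrow> ('m, 'n) chart set" where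
  "charts_at A p = {c \<in> A. p \<in> fst c}"

definition smooth_manifold :: "'m topology \<Rightarrow> ('m, 'n::finite) chart set \<Rightarrow> bool" where
  "smooth_manifold X A \<longleftrightarrow>
     Hausdorff_space X \<and> second_countable X \<and>
     (\<Union>c\<in>A. fst c) = topspace X \<and>
     (\<forall>c\<in>A. openin X (fst c) \<and> open (snd c ` fst c) \<and>
        homeomorphic_map (subtopology X (fst c)) (top_of_set (snd c ` fst c)) (snd c)) \<and>
     (\<forall>c\<in>A. \<forall>d\<in>A. smooth_on (snd c ` (fst c \<inter> fst d)) (snd d \<circ> chart_inv c))"

text \<open>The matrix with the entry \<open>\<partial>x\<^sub>d\<^sup>j / \<partial>x\<^sub>c\<^sup>i\<close> in row \<open>j\<close> and column \<open>i\<close>, at the point \<open>p\<close>.\<close>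

definition chart_jac ::
  "('m, 'n::finite) chart \<Rightarrow> ('m, 'n) chart \<Rightarrow> 'm \<Rightarrow> real^'n^'n" where
  "chart_jac c d p = jacobian (snd d \<circ> chart_inv c) (at (snd c p))"

text \<open>
  A covector at \<open>p\<close> is the family of its components \<open>y\<^sub>i\<close> with respect to all charts around \<open>p\<close>, subject to
  the transformation law of covectors. The value zero at all other charts makes this
  representation unique.
\<close>

type_synonym ('m, 'n) covector = "('m, 'n) chart \<Rightarrow> real^'n"

definition cotangent_space ::
  "('m, 'n::finite) chart set \<Rightarrow> 'm \<Rightarrow> ('m, 'n) covector set" where
  "cotangent_space A p =
     {\<xi>. (\<forall>c\<in>charts_at A p. \<forall>d\<in>charts_at A p. \<xi> c = transpose (chart_jac c d p) *v \<xi> d) \<and>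
         (\<forall>c. c \<notin> charts_at A p \<longrightarrow> \<xi> c = 0)}"

definition cotangent_bundle ::
  "'m topology \<Rightarrow> ('m, 'n::finite) chart set \<Rightarrow> ('m \<times> ('m, 'n) covector) set" where
  "cotangent_bundle X A = (SIGMA p:topspace X. cotangent_space A p)"

definition slit_cotangent_bundle ::
  "'m topology \<Rightarrow> ('m, 'n::finite) chart set \<Rightarrow> ('m \<times> ('m, 'n) covector) set" where
  "slit_cotangent_bundle X A = {u \<in> cotangent_bundle X A. snd u \<noteq> (\<lambda>c. 0)}"

definition cscale ::
  "real \<Rightarrow> 'm \<times> ('m, 'n::finite) covector \<Rightarrow> 'm \<times> ('m, 'n) covector" where
  "cscale k u = (fst u, \<lambda>c. k *\<^sub>R snd u c)"

text \<open>The point of the cotangent bundle with canonical coordinates \<open>(x, y)\<close> in the chart \<open>c\<close>.\<close>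

definition bundle_point ::
  "('m, 'n::finite) chart set \<Rightarrow> ('m, 'n) chart \<Rightarrow> (real^'n) \<times> (real^'n)
     \<Rightarrow> 'm \<times> ('m, 'n) covector" where
  "bundle_point A c z =
     (let p = chart_inv c (fst z)
      in (p, \<lambda>d. if d \<in> charts_at A p then transpose (chart_jac d c p) *v snd z else 0))"

definition coord_image ::
  "('m, 'n::finite) chart set \<Rightarrow> ('m, 'n) chart \<Rightarrow> ('m \<times> ('m, 'n) covector) set
     \<Rightarrow> ((real^'n) \<times> (real^'n)) set" where
  "coord_image A c W = {z. fst z \<in> snd c ` fst c \<and> bundle_point A c z \<in> W}"


section \<open>Metric and vector field\<close>

text \<open>
  Tensor fields are given by their components, as functions of the coordinates \<open>x\<close> of each chart:
  \<open>a c x $ i $ j\<close> is \<open>a\<^sup>i\<^sup>j(x)\<close> and \<open>b c x $ i\<close> is \<open>b\<^sup>i(x)\<close> in the chart \<open>c\<close>.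
\<close>

type_synonym ('m, 'n) tensor2 = "('m, 'n) chart \<Rightarrow> real^'n \<Rightarrow> real^'n^'n"
type_synonym ('m, 'n) vfield = "('m, 'n) chart \<Rightarrow> real^'n \<Rightarrow> real^'n"

definition riemannian_cometric ::
  "('m, 'n::finite) chart set \<Rightarrow> ('m, 'n) tensor2 \<Rightarrow> bool" where
  "riemannian_cometric A a \<longleftrightarrow>
     (\<forall>c\<in>A. smooth_on (snd c ` fst c) (a c) \<and>
        (\<forall>x\<in>snd c ` fst c. transpose (a c x) = a c x \<and> (\<forall>v. v \<noteq> 0 \<longrightarrow> v \<bullet> (a c x *v v) > 0))) \<and>
     (\<forall>p. \<forall>c\<in>charts_at A p. \<forall>d\<in>charts_at A p.
        a d (snd d p) = chart_jac c d p ** a c (snd c p) ** transpose (chart_jac c d p))"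

definition smooth_vector_field ::
  "('m, 'n::finite) chart set \<Rightarrow> ('m, 'n) vfield \<Rightarrow> bool" where
  "smooth_vector_field A b \<longleftrightarrow>
     (\<forall>c\<in>A. smooth_on (snd c ` fst c) (b c)) \<and>
     (\<forall>p. \<forall>c\<in>charts_at A p. \<forall>d\<in>charts_at A p.
        b d (snd d p) = chart_jac c d p *v b c (snd c p))"

definition alpha_in ::
  "('m, 'n::finite) tensor2 \<Rightarrow> ('m, 'n) chart \<Rightarrow> 'm \<times> ('m, 'n) covector \<Rightarrow> real" where
  "alpha_in a c u =
     sqrt (\<Sum>i\<in>UNIV. \<Sum>j\<in>UNIV. a c (snd c (fst u)) $ i $ j * snd u c $ i * snd u c $ j)"

definition beta_in ::
  "('m, 'n::finite) vfield \<Rightarrow> ('m, 'n) chart \<Rightarrow> 'm \<times> ('m, 'n) covector \<Rightarrow> real" where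
  "beta_in b c u = (\<Sum>i\<in>UNIV. b c (snd c (fst u)) $ i * snd u c $ i)"

text \<open>The choice of the chart does not matter, see \<open>alpha_eq\<close> and \<open>beta_eq\<close> below.\<close>

definition alpha ::
  "('m, 'n::finite) chart set \<Rightarrow> ('m, 'n) tensor2 \<Rightarrow> 'm \<times> ('m, 'n) covector \<Rightarrow> real" where
  "alpha A a u = alpha_in a (SOME c. c \<in> charts_at A (fst u)) u"

definition beta ::
  "('m, 'n::finite) chart set \<Rightarrow> ('m, 'n) vfield \<Rightarrow> 'm \<times> ('m, 'n) covector \<Rightarrow> real" where
  "beta A b u = beta_in b (SOME c. c \<in> charts_at A (fst u)) u"

lemma alpha_in_inner:
  "alpha_in a c u = sqrt (snd u c \<bullet> (a c (snd c (fst u)) *v snd u c))"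
  by (simp add: alpha_in_def inner_vec_def matrix_vector_mult_def sum_distrib_left mult.assoc mult.left_commute)

lemma beta_in_inner: "beta_in b c u = b c (snd c (fst u)) \<bullet> snd u c"
  by (simp add: beta_in_def inner_vec_def)

lemma alpha_eq:
  assumes a: "riemannian_cometric A a" and u: "snd u \<in> cotangent_space A (fst u)"
    and c: "c \<in> charts_at A (fst u)"
  shows "alpha A a u = alpha_in a c u"
proof -
  define d where "d = (SOME c. c \<in> charts_at A (fst u))"
  define J where "J = chart_jac c d (fst u)"
  have d: "d \<in> charts_at A (fst u)" unfolding d_def using c by (rule someI)
  have y: "snd u c = transpose J *v snd u d"
    using u c d unfolding cotangent_space_def J_def by blast
  have t: "a d (snd d (fst u)) = J ** a c (snd c (fst u)) ** transpose J"
    using a c d unfolding riemannian_cometric_def J_def by blast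
  have "snd u d \<bullet> (a d (snd d (fst u)) *v snd u d) =
      snd u d \<bullet> (J *v (a c (snd c (fst u)) *v snd u c))"
    by (simp only: t y matrix_vector_mul_assoc[symmetric])
  also have "\<dots> = snd u c \<bullet> (a c (snd c (fst u)) *v snd u c)"
    by (simp only: dot_lmul_matrix[symmetric] y transpose_matrix_vector)
  finally show ?thesis by (simp add: alpha_def alpha_in_inner d_def)
qed

lemma beta_eq:
  assumes b: "smooth_vector_field A b" and u: "snd u \<in> cotangent_space A (fst u)"
    and c: "c \<in> charts_at A (fst u)"
  shows "beta A b u = beta_in b c u"
proof -
  define d where "d = (SOME c. c \<in> charts_at A (fst u))"
  define J where "J = chart_jac c d (fst u)"
  have d: "d \<in> charts_at A (fst u)" unfolding d_def using c by (rule someI)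
  have y: "snd u c = transpose J *v snd u d"
    using u c d unfolding cotangent_space_def J_def by blast
  have t: "b d (snd d (fst u)) = J *v b c (snd c (fst u))"
    using b c d unfolding smooth_vector_field_def J_def by blast
  have "b d (snd d (fst u)) \<bullet> snd u d = b c (snd c (fst u)) \<bullet> snd u c"
    by (simp only: t y dot_lmul_matrix[symmetric] transpose_matrix_vector
        inner_commute[of _ "snd u d"] inner_commute[of "b c (snd c (fst u))"])
  then show ?thesis by (simp add: beta_def beta_in_inner d_def)
qed


section \<open>Cartan spaces\<close>

definition partial_deriv :: "'n::finite \<Rightarrow> (real^'n \<Rightarrow> real) \<Rightarrow> real^'n \<Rightarrow> real" where
  "partial_deriv i f y = frechet_derivative f (at y) (axis i 1)"

definition fundamental_tensor ::
  "('m, 'n::finite) chart set \<Rightarrow> ('m \<times> ('m, 'n) covector \<Rightarrow> real) \<Rightarrow> ('m, 'n) chart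
     \<Rightarrow> (real^'n) \<times> (real^'n) \<Rightarrow> real^'n^'n" where
  "fundamental_tensor A H c z =
     (\<chi> i j. 1/2 * partial_deriv i (partial_deriv j (\<lambda>y. H (bundle_point A c (fst z, y)))) (snd z))"

text \<open>
  The fundamental function need not be defined on the whole slit cotangent bundle. We consider
  it on an open conic subset \<open>W\<close>; its values elsewhere are irrelevant.
\<close>

definition cartan_space ::
  "'m topology \<Rightarrow> ('m, 'n::finite) chart set \<Rightarrow> ('m \<times> ('m, 'n) covector) set
     \<Rightarrow> ('m \<times> ('m, 'n) covector \<Rightarrow> real) \<Rightarrow> bool" where
  "cartan_space X A W H \<longleftrightarrow>
     smooth_manifold X A \<and>
     W \<subseteq> slit_cotangent_bundle X A \<and>
     (\<forall>c\<in>A. open (coord_image A c W)) \<and>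
     (\<forall>c\<in>A. smooth_on (coord_image A c W) (\<lambda>z. H (bundle_point A c z))) \<and>
     (\<forall>u\<in>W. \<forall>k>0. cscale k u \<in> W \<and> H (cscale k u) = k\<^sup>2 * H u) \<and>
     (\<forall>c\<in>A. \<forall>z\<in>coord_image A c W. det (fundamental_tensor A H c z) \<noteq> 0)"

text \<open>
  In \<open>alpha_beta_cartan_space X A a b W H \<Phi>\<close>, the function \<open>\<Phi>\<close> of two real variables expresses \<open>H\<close> in terms
  of \<open>\<alpha>\<close> and \<open>\<beta>\<close>. It is defined and smooth on some open set containing all values of \<open>(\<alpha>, \<beta>)\<close>,
  so that its partial derivatives at these values make sense.
\<close>

definition alpha_beta_cartan_space ::
  "'m topology \<Rightarrow> ('m, 'n::finite) chart set \<Rightarrow> ('m, 'n) tensor2 \<Rightarrow> ('m, 'n) vfield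
     \<Rightarrow> ('m \<times> ('m, 'n) covector) set \<Rightarrow> ('m \<times> ('m, 'n) covector \<Rightarrow> real)
     \<Rightarrow> (real \<Rightarrow> real \<Rightarrow> real) \<Rightarrow> bool" where
  "alpha_beta_cartan_space X A a b W H \<Phi> \<longleftrightarrow>
     cartan_space X A W H \<and> riemannian_cometric A a \<and> smooth_vector_field A b \<and>
     (\<exists>D. open D \<and> smooth_on D (\<lambda>(s, t). \<Phi> s t) \<and> (\<forall>u\<in>W. (alpha A a u, beta A b u) \<in> D)) \<and>
     (\<forall>u\<in>W. H u = \<Phi> (alpha A a u) (beta A b u))"

definition region_U ::
  "'m topology \<Rightarrow> ('m, 'n::finite) chart set \<Rightarrow> ('m, 'n) tensor2 \<Rightarrow> ('m, 'n) vfield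
     \<Rightarrow> ('m \<times> ('m, 'n) covector) set" where
  "region_U X A a b =
     {u \<in> slit_cotangent_bundle X A. beta A b u > 0 \<and> alpha A a u < beta A b u}"


section \<open>The invariants\<close>

definition D\<alpha> :: "(real \<Rightarrow> real \<Rightarrow> real) \<Rightarrow> real \<Rightarrow> real \<Rightarrow> real" where
  "D\<alpha> \<Phi> s t = deriv (\<lambda>s'. \<Phi> s' t) s"

definition D\<beta> :: "(real \<Rightarrow> real \<Rightarrow> real) \<Rightarrow> real \<Rightarrow> real \<Rightarrow> real" where
  "D\<beta> \<Phi> s t = deriv (\<lambda>t'. \<Phi> s t') t"

definition inv_rho1 :: "(real \<Rightarrow> real \<Rightarrow> real) \<Rightarrow> real \<Rightarrow> real \<Rightarrow> real" where
  "inv_rho1 \<Phi> s t = 1/2 * D\<beta> \<Phi> s t"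

definition inv_rho :: "(real \<Rightarrow> real \<Rightarrow> real) \<Rightarrow> real \<Rightarrow> real \<Rightarrow> real" where
  "inv_rho \<Phi> s t = 1 / (2 * s) * D\<alpha> \<Phi> s t"

definition inv_rho0 :: "(real \<Rightarrow> real \<Rightarrow> real) \<Rightarrow> real \<Rightarrow> real \<Rightarrow> real" where
  "inv_rho0 \<Phi> s t = 1/2 * D\<beta> (D\<beta> \<Phi>) s t"

definition inv_rho_m1 :: "(real \<Rightarrow> real \<Rightarrow> real) \<Rightarrow> real \<Rightarrow> real \<Rightarrow> real" where
  "inv_rho_m1 \<Phi> s t = 1 / (2 * s) * D\<beta> (D\<alpha> \<Phi>) s t"

definition inv_rho_m2 :: "(real \<Rightarrow> real \<Rightarrow> real) \<Rightarrow> real \<Rightarrow> real \<Rightarrow> real" where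
  "inv_rho_m2 \<Phi> s t = 1 / (2 * s^2) * (D\<alpha> (D\<alpha> \<Phi>) s t - 1 / s * D\<alpha> \<Phi> s t)"

definition inv_r_m1 :: "(real \<Rightarrow> real \<Rightarrow> real) \<Rightarrow> real \<Rightarrow> real \<Rightarrow> real" where
  "inv_r_m1 \<Phi> s t = 1/2 * D\<beta> (D\<beta> (D\<beta> \<Phi>)) s t"

definition inv_r_m2 :: "(real \<Rightarrow> real \<Rightarrow> real) \<Rightarrow> real \<Rightarrow> real \<Rightarrow> real" where
  "inv_r_m2 \<Phi> s t = 1 / (2 * s) * D\<beta> (D\<beta> (D\<alpha> \<Phi>)) s t"

definition inv_r_m3 :: "(real \<Rightarrow> real \<Rightarrow> real) \<Rightarrow> real \<Rightarrow> real \<Rightarrow> real" where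
  "inv_r_m3 \<Phi> s t = 1 / (2 * s^2) * (D\<beta> (D\<alpha> (D\<alpha> \<Phi>)) s t - 1 / s * D\<beta> (D\<alpha> \<Phi>) s t)"

definition inv_r_m4 :: "(real \<Rightarrow> real \<Rightarrow> real) \<Rightarrow> real \<Rightarrow> real \<Rightarrow> real" where
  "inv_r_m4 \<Phi> s t = 1 / (2 * s^3) *
     (D\<alpha> (D\<alpha> (D\<alpha> \<Phi>)) s t - 3 / s * D\<alpha> (D\<alpha> \<Phi>) s t + 3 / s^2 * D\<alpha> \<Phi> s t)"

end

theory Submission
  imports Defs
begin

text \<open>
  By homogeneity of \<open>H\<close>, Euler's relation \<open>2 H = \<alpha> H\<^sub>\<alpha> + \<beta> H\<^sub>\<beta>\<close> holds at every value of \<open>(\<alpha>, \<beta>)\<close>, and the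
  invariants \<open>\<rho>\<close> and \<open>\<rho>\<^sub>1\<close> determine \<open>H\<^sub>\<alpha>\<close> and \<open>H\<^sub>\<beta>\<close>, because \<open>\<alpha> > 0\<close> off the zero section.
\<close>

text \<open>On an open set derivatives depend only on the values there. This allows a derivative
  known only on \<open>S\<close> to be replaced by a closed expression for it.\<close>

lemma Ck_on_cong:
  assumes "open S" and "\<And>x. x \<in> S \<Longrightarrow> f x = g x" and "Ck_on k S f"
  shows "Ck_on k S g"
  using assms(2,3)
proof (induction k arbitrary: f g)
  case 0
  then show ?case using continuous_on_cong[OF refl, of S f g] by simp
next
  case (Suc k)
  \<comment> \<open>The equivalence covers every \<open>L\<close>, so that the choice operator
    behind \<open>frechet_derivative\<close> picks the same map for \<open>f\<close> and
    \<open>g\<close>.\<close>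
  have der: "(f has_derivative L) (at x) \<longleftrightarrow> (g has_derivative L) (at x)" if "x \<in> S" for x L
  proof
    show "(g has_derivative L) (at x)" if "(f has_derivative L) (at x)"
      using that assms(1) \<open>x \<in> S\<close> by (rule has_derivative_transform_within_open) (rule Suc.prems(1))
    show "(f has_derivative L) (at x)" if "(g has_derivative L) (at x)"
      using that assms(1) \<open>x \<in> S\<close>
      by (rule has_derivative_transform_within_open) (rule Suc.prems(1)[symmetric])
  qed
  then have "frechet_derivative f (at x) = frechet_derivative g (at x)" if "x \<in> S" for x
    using that by (simp add: frechet_derivative_def)
  moreover have "\<forall>x\<in>S. g differentiable (at x)"
    using Suc.prems(2) der by (auto simp: differentiable_def)
  ultimately show ?case
    using Suc.prems(2) Suc.IH[of "\<lambda>x. frechet_derivative f (at x) v"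
        "\<lambda>x. frechet_derivative g (at x) v" for v]
    by auto
qed

text \<open>Smoothness without tracking the order of differentiation: \<open>P\<close> survives
  every directional derivative, so induction on the order, for all members of \<open>P\<close> at
  once, goes through.\<close>

lemma smooth_on_coinduct:
  assumes "open S" and "P f"
    and diff: "\<And>f x. P f \<Longrightarrow> x \<in> S \<Longrightarrow> f differentiable (at x)"
    and step: "\<And>f v. P f \<Longrightarrow> \<exists>g. P g \<and> (\<forall>x\<in>S. frechet_derivative f (at x) v = g x)"
  shows "smooth_on S f"
proof -
  have "Ck_on k S f" if "P f" for k f
    using that
  proof (induction k arbitrary: f)
    case 0
    have "isCont f x" if "x \<in> S" for x
      using diff[OF 0 that] by (rule differentiable_imp_continuous_within)
    then show ?case by (simp add: continuous_at_imp_continuous_on)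
  next
    case (Suc k)
    have "Ck_on k S (\<lambda>x. frechet_derivative f (at x) v)" for v
    proof -
      obtain g where g: "P g" "\<forall>x\<in>S. frechet_derivative f (at x) v = g x"
        using step[OF Suc.prems, of v] by (elim exE conjE)
      show ?thesis
        by (rule Ck_on_cong[OF assms(1) _ Suc.IH[OF g(1)]]) (simp add: g(2))
    qed
    moreover have "\<forall>x\<in>S. f differentiable (at x)"
      using diff[OF Suc.prems] by (rule ballI)
    ultimately show ?case by simp
  qed
  from this[OF assms(2)] show ?thesis unfolding smooth_on_def by (rule allI)
qed

text \<open>The rational functions without poles in \<open>S\<close>, generated by closure rules
  rather than written as quotients of polynomials, so that rule induction can differentiate
  them.\<close>

inductive rational_on :: "'a::real_normed_vector set \<Rightarrow> ('a \<Rightarrow> real) \<Rightarrow> bool" for S where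
  const: "rational_on S (\<lambda>x. c)"
| linear: "bounded_linear l \<Longrightarrow> rational_on S l"
| add: "rational_on S f \<Longrightarrow> rational_on S g \<Longrightarrow> rational_on S (\<lambda>x. f x + g x)"
| mult: "rational_on S f \<Longrightarrow> rational_on S g \<Longrightarrow> rational_on S (\<lambda>x. f x * g x)"
| inverse: "rational_on S f \<Longrightarrow> (\<And>x. x \<in> S \<Longrightarrow> f x \<noteq> 0) \<Longrightarrow> rational_on S (\<lambda>x. inverse (f x))"

text \<open>The sum, product and reciprocal rules lead only to operations under which the class is
  closed; this is the invariance that \<open>smooth_on_coinduct\<close> asks for.\<close>

lemma rational_on_has_derivative:
  assumes "rational_on S f"
  shows "\<exists>f'. (\<forall>x\<in>S. (f has_derivative f' x) (at x)) \<and> (\<forall>v. rational_on S (\<lambda>x. f' x v))"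
  using assms
proof induction
  case (const c)
  show ?case by (rule exI[of _ "\<lambda>x v. 0"]) (simp add: rational_on.const)
next
  case (linear l)
  \<comment> \<open>The derivative is \<open>l\<close> at every point, hence constant in
    \<open>x\<close> for a fixed direction.\<close>
  then show ?case
    by (intro exI[of _ "\<lambda>x. l"]) (simp add: rational_on.const bounded_linear_imp_has_derivative)
next
  case (add f g)
  then obtain f' g' where
    "\<forall>x\<in>S. (f has_derivative f' x) (at x)" "\<forall>v. rational_on S (\<lambda>x. f' x v)"
    "\<forall>x\<in>S. (g has_derivative g' x) (at x)" "\<forall>v. rational_on S (\<lambda>x. g' x v)"
    by blast
  then show ?case
    by (intro exI[of _ "\<lambda>x v. f' x v + g' x v"]) (simp add: rational_on.add has_derivative_add)
next
  case (mult f g)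
  then obtain f' g' where
    "\<forall>x\<in>S. (f has_derivative f' x) (at x)" "\<forall>v. rational_on S (\<lambda>x. f' x v)"
    "\<forall>x\<in>S. (g has_derivative g' x) (at x)" "\<forall>v. rational_on S (\<lambda>x. g' x v)"
    by blast
  with mult.hyps show ?case
    by (intro exI[of _ "\<lambda>x v. f x * g' x v + f' x v * g x"])
      (simp add: rational_on.add rational_on.mult has_derivative_mult)
next
  case (inverse f)
  then obtain f' where
    f': "\<forall>x\<in>S. (f has_derivative f' x) (at x)" "\<forall>v. rational_on S (\<lambda>x. f' x v)"
    by blast
  have inv: "rational_on S (\<lambda>x. inverse (f x))"
    using inverse.hyps by (intro rational_on.inverse)
  \<comment> \<open>Negation is expressed as multiplication by the constant -1, which the rules of
    the class provide.\<close>
  have "rational_on S (\<lambda>x. -1 * (inverse (f x) * f' x v * inverse (f x)))" for v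
    using rational_on.mult[OF rational_on.const
        rational_on.mult[OF rational_on.mult[OF inv spec[OF f'(2)]] inv]] .
  with f' inverse.hyps show ?case
    by (intro exI[of _ "\<lambda>x v. - (inverse (f x) * f' x v * inverse (f x))"])
      (simp add: has_derivative_inverse)
qed

lemma rational_on_imp_smooth_on:
  fixes f :: "'a::euclidean_space \<Rightarrow> real"
  assumes "open S" and "rational_on S f"
  shows "smooth_on S f"
proof (rule smooth_on_coinduct[where P = "rational_on S"])
  show "f differentiable (at x)" if "rational_on S f" "x \<in> S" for f x
    using rational_on_has_derivative[OF that(1)] that(2) by (auto simp: differentiable_def)
  show "\<exists>g. rational_on S g \<and> (\<forall>x\<in>S. frechet_derivative f (at x) v = g x)"
    if f: "rational_on S f" for f v
  proof -
    obtain f' where "\<forall>x\<in>S. (f has_derivative f' x) (at x)" "\<forall>v. rational_on S (\<lambda>x. f' x v)"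
      using rational_on_has_derivative[OF f] by blast
    then show ?thesis
      by (intro exI[of _ "\<lambda>x. f' x v"]) (auto simp: frechet_derivative_at[symmetric])
  qed
qed (use assms in auto)

text \<open>Provides the smoothness that \<open>alpha_beta_cartan_space\<close> demands of the new
  function; the denominator does not vanish on this half-plane.\<close>

lemma smooth_on_fundamental_function:
  "smooth_on {z::real \<times> real. fst z < snd z} (\<lambda>(s, t). s * t ^ 2 / (t - s))"
proof -
  let ?D = "{z::real \<times> real. fst z < snd z}"
  have "open ?D"
    by (intro open_Collect_less continuous_intros)
  moreover have "rational_on ?D (\<lambda>z. fst z * (snd z * snd z) * inverse (snd z + (-1) * fst z))"
    by (intro rational_on.intros bounded_linear_fst bounded_linear_snd) auto
  ultimately show ?thesis
    using rational_on_imp_smooth_on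
    by (simp add: case_prod_unfold power2_eq_square divide_inverse)
qed

text \<open>Differentiate \<open>\<Phi>\<close> along the ray through \<open>(s, t)\<close> at
  \<open>k = 1\<close>, once by the chain rule and once by homogeneity. Homogeneity is assumed on
  this one ray only, since it will be known only at values taken by \<alpha> and \<beta>.\<close>

lemma euler_relation:
  assumes diff: "(\<lambda>(s, t). \<Phi> s t) differentiable (at (s, t))"
    and hom: "\<And>k. k > 0 \<Longrightarrow> \<Phi> (k * s) (k * t) = k\<^sup>2 * \<Phi> s t"
  shows "s * D\<alpha> \<Phi> s t + t * D\<beta> \<Phi> s t = 2 * \<Phi> s t"
proof -
  obtain L where L: "((\<lambda>(s, t). \<Phi> s t) has_derivative L) (at (s, t))"
    using diff by (auto simp: differentiable_def)
  then interpret L: bounded_linear L by (rule has_derivative_bounded_linear)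
  \<comment> \<open>The curve \<open>p\<close> will be each of the two coordinate lines, giving the
    partial derivatives, and then the ray.\<close>
  have chain: "((\<lambda>k. \<Phi> (fst (p k)) (snd (p k))) has_real_derivative L v) (at k)"
    if "p k = (s, t)" and "(p has_vector_derivative v) (at k)" for p v k
  proof -
    have "((\<lambda>(s, t). \<Phi> s t) \<circ> p has_derivative L \<circ> (\<lambda>h. h *\<^sub>R v)) (at k)"
      using that L by (intro diff_chain_at) (auto simp: has_vector_derivative_def)
    moreover have "L \<circ> (\<lambda>h. h *\<^sub>R v) = (*) (L v)"
      by (auto simp: L.scaleR)
    ultimately show ?thesis
      by (simp add: has_field_derivative_def comp_def case_prod_unfold)
  qed
  have "((\<lambda>s'. (s', t)) has_vector_derivative (1, 0)) (at s)"
    by (auto intro!: derivative_eq_intros simp: has_vector_derivative_def)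
  from chain[OF _ this] have D\<alpha>: "D\<alpha> \<Phi> s t = L (1, 0)"
    by (simp add: D\<alpha>_def DERIV_imp_deriv)
  have "((\<lambda>t'. (s, t')) has_vector_derivative (0, 1)) (at t)"
    by (auto intro!: derivative_eq_intros simp: has_vector_derivative_def)
  from chain[OF _ this] have D\<beta>: "D\<beta> \<Phi> s t = L (0, 1)"
    by (simp add: D\<beta>_def DERIV_imp_deriv)
  have "((\<lambda>k. (k * s, k * t)) has_vector_derivative (s, t)) (at 1)"
    by (auto intro!: derivative_eq_intros simp: has_vector_derivative_def)
  from chain[OF _ this] have "((\<lambda>k. \<Phi> (k * s) (k * t)) has_real_derivative L (s, t)) (at 1)"
    by simp
  \<comment> \<open>Homogeneity holds for positive \<open>k\<close>, which is enough on a
    neighbourhood of 1.\<close>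
  then have "((\<lambda>k. k\<^sup>2 * \<Phi> s t) has_real_derivative L (s, t)) (at 1)"
    by (rule has_field_derivative_transform_within_open[where S = "{0<..}"]) (auto simp: hom)
  moreover have "((\<lambda>k. k\<^sup>2 * \<Phi> s t) has_real_derivative 2 * \<Phi> s t) (at 1)"
    by (auto intro!: derivative_eq_intros)
  ultimately have "L (s, t) = 2 * \<Phi> s t"
    by (rule DERIV_unique)
  moreover have "L (s, t) = L (s *\<^sub>R (1, 0) + t *\<^sub>R (0, 1))"
    by simp
  ultimately show ?thesis
    unfolding D\<alpha> D\<beta> by (simp only: L.add L.scaleR real_scaleR_def)
qed

text \<open>Scaling keeps the base point and hence the chosen chart. The sign of \<open>k\<close>
  matters because the root of its square is its absolute value.\<close>

lemma alpha_cscale: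
  assumes "k > 0"
  shows "alpha A a (cscale k u) = k * alpha A a u"
  using assms
  by (simp add: alpha_def alpha_in_inner cscale_def real_sqrt_mult matrix_vector_mult_scaleR)

lemma beta_cscale: "beta A b (cscale k u) = k * beta A b u"
  by (simp add: beta_def beta_in_inner cscale_def)

lemma alpha_pos:
  assumes a: "riemannian_cometric A a" and u: "u \<in> slit_cotangent_bundle X A"
  shows "alpha A a u > 0"
proof -
  have cov: "snd u \<in> cotangent_space A (fst u)" and "snd u \<noteq> (\<lambda>c. 0)"
    using u by (auto simp: slit_cotangent_bundle_def cotangent_bundle_def)
  then obtain c where nz: "snd u c \<noteq> 0" by blast
  \<comment> \<open>Covectors are zero by convention at charts not around the base point, so a
    nonzero component belongs to a chart where the metric is positive definite.\<close>
  then have c: "c \<in> charts_at A (fst u)"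
    using cov unfolding cotangent_space_def by blast
  then have "snd u c \<bullet> (a c (snd c (fst u)) *v snd u c) > 0"
    using a nz by (auto simp: riemannian_cometric_def charts_at_def)
  then show ?thesis
    by (simp add: alpha_eq[OF a cov c] alpha_in_inner)
qed

theorem theorem5p2:
  fixes X :: "'m topology" and A :: "('m, 'n::finite) chart set"
    and a :: "('m, 'n) tensor2" and b :: "('m, 'n) vfield"
    and H :: "'m \<times> ('m, 'n) covector \<Rightarrow> real" and \<Phi> :: "real \<Rightarrow> real \<Rightarrow> real"
  defines "U \<equiv> region_U X A a b" and "\<alpha> \<equiv> alpha A a" and "\<beta> \<equiv> beta A b"
  assumes space: "alpha_beta_cartan_space X A a b U H \<Phi>"
    and rho1: "\<And>u. u \<in> U \<Longrightarrow> inv_rho1 \<Phi> (\<alpha> u) (\<beta> u) =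
      (\<alpha> u * \<beta> u ^ 2 - 2 * \<alpha> u ^ 2 * \<beta> u) / (2 * (\<beta> u - \<alpha> u) ^ 2)"
    and rho: "\<And>u. u \<in> U \<Longrightarrow> inv_rho \<Phi> (\<alpha> u) (\<beta> u) =
      \<beta> u ^ 3 / (2 * \<alpha> u * (\<beta> u - \<alpha> u) ^ 2)"
    and rho0: "\<And>u. u \<in> U \<Longrightarrow> inv_rho0 \<Phi> (\<alpha> u) (\<beta> u) =
      \<alpha> u ^ 3 / (\<beta> u - \<alpha> u) ^ 3"
    and rho_m1: "\<And>u. u \<in> U \<Longrightarrow> inv_rho_m1 \<Phi> (\<alpha> u) (\<beta> u) =
      (\<beta> u ^ 3 - 3 * \<alpha> u * \<beta> u ^ 2) / (2 * \<alpha> u * (\<beta> u - \<alpha> u) ^ 3)"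
    and rho_m2: "\<And>u. u \<in> U \<Longrightarrow> inv_rho_m2 \<Phi> (\<alpha> u) (\<beta> u) =
      \<beta> u ^ 3 * (3 * \<alpha> u - \<beta> u) / (2 * \<alpha> u ^ 3 * (\<beta> u - \<alpha> u) ^ 3)"
    and r_m1: "\<And>u. u \<in> U \<Longrightarrow> inv_r_m1 \<Phi> (\<alpha> u) (\<beta> u) =
      (- 3 * \<alpha> u ^ 3) / (\<beta> u - \<alpha> u) ^ 4"
    and r_m2: "\<And>u. u \<in> U \<Longrightarrow> inv_r_m2 \<Phi> (\<alpha> u) (\<beta> u) =
      3 * \<alpha> u * \<beta> u / (\<beta> u - \<alpha> u) ^ 4"
    and r_m3: "\<And>u. u \<in> U \<Longrightarrow> inv_r_m3 \<Phi> (\<alpha> u) (\<beta> u) =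
      (4 * \<alpha> u * \<beta> u ^ 3 - \<beta> u ^ 4 - 9 * \<alpha> u ^ 2 * \<beta> u ^ 2)
        / (2 * \<alpha> u ^ 3 * (\<beta> u - \<alpha> u) ^ 4)"
    and r_m4: "\<And>u. u \<in> U \<Longrightarrow> inv_r_m4 \<Phi> (\<alpha> u) (\<beta> u) =
      (15 * \<alpha> u ^ 2 * \<beta> u ^ 3 + 3 * \<beta> u ^ 5 - 12 * \<alpha> u * \<beta> u ^ 4)
        / (2 * \<alpha> u ^ 5 * (\<beta> u - \<alpha> u) ^ 4)"
  shows "alpha_beta_cartan_space X A a b U H (\<lambda>s t. s * t ^ 2 / (t - s))"
proof -
  have cartan: "cartan_space X A U H" and a: "riemannian_cometric A a"
    and b: "smooth_vector_field A b"
    and H: "\<And>u. u \<in> U \<Longrightarrow> H u = \<Phi> (\<alpha> u) (\<beta> u)"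
    using space by (auto simp: alpha_beta_cartan_space_def \<alpha>_def \<beta>_def)
  obtain D where D: "smooth_on D (\<lambda>(s, t). \<Phi> s t)" "\<And>u. u \<in> U \<Longrightarrow> (\<alpha> u, \<beta> u) \<in> D"
    using space by (auto simp: alpha_beta_cartan_space_def \<alpha>_def \<beta>_def)
  have diff: "(\<lambda>(s, t). \<Phi> s t) differentiable (at z)" if "z \<in> D" for z
  proof -
    have "Ck_on (Suc 0) D (\<lambda>(s, t). \<Phi> s t)"
      using D(1) unfolding smooth_on_def by blast
    then show ?thesis using that by simp
  qed
  have U: "\<alpha> u > 0" "\<alpha> u < \<beta> u" if "u \<in> U" for u
    using that alpha_pos[OF a, of u X] by (auto simp: U_def region_U_def \<alpha>_def \<beta>_def)
  have formula: "H u = \<alpha> u * \<beta> u ^ 2 / (\<beta> u - \<alpha> u)" if u: "u \<in> U" for u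
  proof -
    define s t where "s = \<alpha> u" and "t = \<beta> u"
    have st: "s > 0" "t - s \<noteq> 0" using U[OF u] by (auto simp: s_def t_def)
    \<comment> \<open>\<open>U\<close> is conic, so the homogeneity of \<open>H\<close> passes to
      \<open>\<Phi>\<close> along the ray of values at the multiples of \<open>u\<close>.\<close>
    have "\<Phi> (k * s) (k * t) = k\<^sup>2 * \<Phi> s t" if "k > 0" for k
    proof -
      have "cscale k u \<in> U" "H (cscale k u) = k\<^sup>2 * H u"
        using cartan u that by (auto simp: cartan_space_def)
      then show ?thesis
        using H[of "cscale k u"] H[OF u] that
        by (simp add: s_def t_def \<alpha>_def \<beta>_def alpha_cscale beta_cscale)
    qed
    then have "2 * \<Phi> s t = s * D\<alpha> \<Phi> s t + t * D\<beta> \<Phi> s t"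
      using euler_relation diff D(2)[OF u] by (simp add: s_def t_def)
    \<comment> \<open>Multiplying the formula for \<rho> by \<open>2 * s\<close> isolates the
      derivative, as \<open>s\<close> is positive.\<close>
    also have "D\<alpha> \<Phi> s t = t ^ 3 / (t - s) ^ 2"
      using arg_cong[OF rho[OF u], of "\<lambda>x. 2 * s * x"] st
      by (simp add: inv_rho_def flip: s_def t_def)
    also have "D\<beta> \<Phi> s t = (s * t ^ 2 - 2 * s ^ 2 * t) / (t - s) ^ 2"
      using arg_cong[OF rho1[OF u], of "\<lambda>x. 2 * x"] st
      by (simp add: inv_rho1_def divide_simps flip: s_def t_def)
    \<comment> \<open>The numerators add up to \<open>2 * s * t ^ 3 - 2 * s ^ 2 * t ^ 2\<close>,
      which contains the factor \<open>t - s\<close> that cancels next.\<close>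
    also have "s * (t ^ 3 / (t - s) ^ 2) + t * ((s * t ^ 2 - 2 * s ^ 2 * t) / (t - s) ^ 2) =
        2 * (s * t ^ 2 * (t - s)) / (t - s) ^ 2"
      by (simp add: add_divide_distrib[symmetric] algebra_simps power2_eq_square power3_eq_cube)
    also have "\<dots> = 2 * (s * t ^ 2 / (t - s))"
      using st by (simp add: power2_eq_square)
    finally show ?thesis using H[OF u] by (simp add: s_def t_def)
  qed
  \<comment> \<open>This half-plane replaces \<open>D\<close> as the domain for the new function,
    because \<open>D\<close> may meet the line \<open>s = t\<close>. The Cartan space structure
    carries over, as \<open>H\<close> itself is unchanged.\<close>
  have "open {z::real \<times> real. fst z < snd z}"
    by (intro open_Collect_less continuous_intros)
  moreover have "\<forall>u\<in>U. (alpha A a u, beta A b u) \<in> {z. fst z < snd z}"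
    using U by (auto simp: \<alpha>_def \<beta>_def)
  ultimately show ?thesis
    using cartan a b formula smooth_on_fundamental_function
    unfolding alpha_beta_cartan_space_def \<alpha>_def \<beta>_def by blast
qed

end
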